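(* Let $\mathcal{L}$ be a countable relational language, let $\mathcal{T}$ be a countable predicate $\sigma$-coherent theory over $\mathcal{L}$, and let $\vec{x}.\varphi$ and $\vec{x}.\psi$ be predicate $\sigma$-coherent formulas over $\mathcal{L}$ in the same context $\vec{x}$. Then $\varphi\vdash_{\vec{x}}\psi$ is derivable from $\mathcal{T}$ (written $\varphi\vdash^{\mathcal{T}}_{\vec{x}}\psi$) if and only if $[\![\vec{x}.\varphi]\!]^{\mathcal{T}}\leq[\![\vec{x}.\psi]\!]^{\mathcal{T}}$, i.e. if and only if $[\![\vec{x}.\varphi]\!](M)\subseteq[\![\vec{x}.\psi]\!](M)$ for every $\mathcal{T}$-model $M$ (in the sense of countable structures presented on $\mathbb{N}$, defined in the context).
   Context: Syntax. A language $\mathcal{L}$ is a countable set of predicate symbols, each with a finite arity (single sort, no function symbols). There is a countable supply of variables. A context $\vec{x}$ is a finite list of distinct variables; a finite list (of variables or numbers) is compatible with $\vec{x}$ if it has the same length. Predicate $\sigma$-coherent formulas in context are defined inductively: $\vec{x}.\bot$; $\vec{x}.\top$; $\vec{x}.\,x_i=x_j$ for $x_i,x_j\in\vec{x}$; $\vec{x}.P(x_{i_1},\dots,x_{i_n})$ for $n$-ary $P\in\mathcal{L}$ and $x_{i_k}\in\vec{x}$; $\vec{x}.(\varphi\wedge\psi)$ if $\vec{x}.\varphi,\vec{x}.\psi$ are formulas; $\vec{x}.\bigvee_{i\in\mathbb{N}}\varphi_i$ if all $\vec{x}.\varphi_i$ are formulas; $\vec{x}.(\exists y)\varphi$ if $\vec{x},y.\varphi$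 is a formula. Formulas are identified up to renaming of bound variables, and a formula in context $\vec{x}$ may also be regarded as a formula in a larger context. Inference rules for sequents $\varphi\vdash_{\vec{x}}\psi$ (with $\varphi,\psi$ in context $\vec{x}$): - $\varphi\vdash_{\vec{x}}\varphi$; from $\varphi\vdash_{\vec{x}}\psi$ and $\psi\vdash_{\vec{x}}\chi$ infer $\varphi\vdash_{\vec{x}}\chi$; - $\varphi\wedge\bigvee_{i\in\mathbb{N}}\psi_i\vdash_{\vec{x}}\bigvee_{i\in\mathbb{N}}(\varphi\wedge\psi_i)$; - $\varphi\vdash_{\vec{x}}\top$; $\varphi\wedge\psi\vdash_{\vec{x}}\varphi$; $\varphi\wedge\psi\vdash_{\vec{x}}\psi$; from $\chi\vdash_{\vec{x}}\varphi$ and $\chi\vdash_{\vec{x}}\psi$ infer $\chi\vdash_{\vec{x}}\varphi\wedge\psi$; - $\bot\vdash_{\vec{x}}\psi$; $\varphi_j\vdash_{\vec{x}}\bigvee_{i\in\mathbb{N}}\varphi_i$ for $j\in\mathbb{N}$; from $\varphi_i\vdash_{\vec{x}}\psi$ for all $i\in\mathbb{N}$ infer $\bigvee_{i\in\mathbb{N}}\varphi_i\vdash_{\vec{x}}\psi$; - (substitution) from $\varphi\vdash_{\vec{x}}\psi$ infer $\varphi[\vec{s}/\vec{x}]\vdash_{\vec{y}}\psi[\vec{s}/\vec{x}]$, where $\vec{s}$ is a list of variables (repetitions allowed) compatible with $\vec{x}$ and $\vec{y}$ is any context containing all variables of $\vec{s}$; - $\top\vdash_{\vec{x}}x=x$ for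 $x\in\vec{x}$; $(\vec{x}=\vec{y})\wedge\varphi\vdash_{\vec{z}}\varphi[\vec{y}/\vec{x}]$, where $\vec{z}$ contains all variables in $\vec{x},\vec{y}$ and those free in $\varphi$; - from $\varphi\vdash_{\vec{x},y}\psi$ infer $(\exists y)\varphi\vdash_{\vec{x}}\psi$, and conversely (where $\psi$ is a formula in context $\vec{x}$); - $\varphi\wedge(\exists y)\psi\vdash_{\vec{x}}(\exists y)(\varphi\wedge\psi)$ (where $\varphi$ is a formula in context $\vec{x}$). A countable predicate $\sigma$-coherent theory is a countable set $\mathcal{T}$ of such sequents (axioms); a sequent is derivable from $\mathcal{T}$ if it has a (well-founded, possibly infinitely branching) derivation from the rules and the axioms of $\mathcal{T}$. Structures. An $\mathcal{L}$-structure $M$ consists of a partial equivalence relation (symmetric, transitive relation) $\equiv_M$ on $\mathbb{N}$ together with, for each $n$-ary $P\in\mathcal{L}$, a relation $[\![P]\!]_M\subseteq\mathbb{N}^n$ such that $[\![P]\!]_M(a_1,\dots,a_n)$ implies $a_i\equiv_M a_i$ for all $i$, and $[\![P]\!]_M(a_1,\dots,a_n)$ with $a_i\equiv_M b_i$ for all $i$ implies $[\![P]\!]_M(b_1,\dots,b_n)$. Write $a\in M$ for $a\equiv_M a$. The domain may be empty. Satisfaction $M\vDash(\vec{x}.\varphi)(\vec{a})$, for $\vec{a}\in\mathbb{N}^*$ (the set of finite sequences of natural numbers) compatible with $\vec{x}$: never for $\bot$; for $\top$ iff all $a_k\in M$; for $x_i=x_j$ iff $a_i\equiv_M a_j$ and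 all $a_k\in M$; for $P(x_{i_1},\dots,x_{i_n})$ iff $[\![P]\!]_M(a_{i_1},\dots,a_{i_n})$ and all $a_k\in M$; for $\varphi\wedge\psi$ iff both; for $\bigvee_i\varphi_i$ iff some $\varphi_i$; for $(\exists y)\varphi$ iff $M\vDash(\vec{x},y.\varphi)(\vec{a},b)$ for some $b\in M$. Set $[\![\vec{x}.\varphi]\!](M)=\{\vec{a}\mid M\vDash(\vec{x}.\varphi)(\vec{a})\}$. $M$ is a $\mathcal{T}$-model if $[\![\vec{y}.\sigma]\!](M)\subseteq[\![\vec{y}.\theta]\!](M)$ for each axiom $\sigma\vdash_{\vec{y}}\theta$ of $\mathcal{T}$. *)

theory Defs
  imports Main "HOL-Library.Countable_Set"
begin

text \<open>
  Variables are natural numbers. Formulas are identified up to renaming of bound variables by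
  using the locally nameless representation: a bound occurrence is a de Bruijn index \<open>BV k\<close>,
  a free occurrence is a named variable \<open>FV v\<close>. The formula \<open>(\<exists>y)\<phi>\<close> with a named bound
  variable is \<open>exists_fm y \<phi>\<close> below. A language is a set \<open>L\<close> of predicate symbols with an arity
  function \<open>ar\<close>; values of \<open>ar\<close> outside \<open>L\<close> are irrelevant.
\<close>

type_synonym var = nat

datatype tm = FV var | BV nat

datatype 'p fm =
    Bot
  | Top
  | Eq tm tm
  | Rel 'p "tm list"
  | And "'p fm" "'p fm"
  | Disj "nat \<Rightarrow> 'p fm"
  | ExB "'p fm"

primrec close_tm :: "var \<Rightarrow> nat \<Rightarrow> tm \<Rightarrow> tm" where
  "close_tm y k (FV v) = (if v = y then BV k else FV v)"
| "close_tm y k (BV i) = BV i"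

primrec close_fm :: "var \<Rightarrow> nat \<Rightarrow> 'p fm \<Rightarrow> 'p fm" where
  "close_fm y k Bot = Bot"
| "close_fm y k Top = Top"
| "close_fm y k (Eq s t) = Eq (close_tm y k s) (close_tm y k t)"
| "close_fm y k (Rel P ts) = Rel P (map (close_tm y k) ts)"
| "close_fm y k (And \<phi> \<psi>) = And (close_fm y k \<phi>) (close_fm y k \<psi>)"
| "close_fm y k (Disj \<Phi>) = Disj (\<lambda>i. close_fm y k (\<Phi> i))"
| "close_fm y k (ExB \<phi>) = ExB (close_fm y (Suc k) \<phi>)"

definition exists_fm :: "var \<Rightarrow> 'p fm \<Rightarrow> 'p fm" where
  "exists_fm y \<phi> = ExB (close_fm y 0 \<phi>)"

primrec rename_tm :: "(var \<Rightarrow> var) \<Rightarrow> tm \<Rightarrow> tm" where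
  "rename_tm f (FV v) = FV (f v)"
| "rename_tm f (BV i) = BV i"

primrec rename_fm :: "(var \<Rightarrow> var) \<Rightarrow> 'p fm \<Rightarrow> 'p fm" where
  "rename_fm f Bot = Bot"
| "rename_fm f Top = Top"
| "rename_fm f (Eq s t) = Eq (rename_tm f s) (rename_tm f t)"
| "rename_fm f (Rel P ts) = Rel P (map (rename_tm f) ts)"
| "rename_fm f (And \<phi> \<psi>) = And (rename_fm f \<phi>) (rename_fm f \<psi>)"
| "rename_fm f (Disj \<Phi>) = Disj (\<lambda>i. rename_fm f (\<Phi> i))"
| "rename_fm f (ExB \<phi>) = ExB (rename_fm f \<phi>)"

text \<open>\<open>subst_fm xs ss \<phi>\<close> is the simultaneous substitution \<open>\<phi>[ss/xs]\<close>. It cannot capture, since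
  bound variables have no names.\<close>

definition subst_var :: "var list \<Rightarrow> var list \<Rightarrow> var \<Rightarrow> var" where
  "subst_var xs ss v = (case map_of (zip xs ss) v of Some w \<Rightarrow> w | None \<Rightarrow> v)"

definition subst_fm :: "var list \<Rightarrow> var list \<Rightarrow> 'p fm \<Rightarrow> 'p fm" where
  "subst_fm xs ss = rename_fm (subst_var xs ss)"

inductive formula :: "'p set \<Rightarrow> ('p \<Rightarrow> nat) \<Rightarrow> var list \<Rightarrow> 'p fm \<Rightarrow> bool"
  for L :: "'p set" and ar :: "'p \<Rightarrow> nat" where
  Bot: "distinct xs \<Longrightarrow> formula L ar xs Bot"
| Top: "distinct xs \<Longrightarrow> formula L ar xs Top"
| Eq: "distinct xs \<Longrightarrow> u \<in> set xs \<Longrightarrow> v \<in> set xs \<Longrightarrow> formula L ar xs (Eq (FV u) (FV v))"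
| Rel: "distinct xs \<Longrightarrow> P \<in> L \<Longrightarrow> length vs = ar P \<Longrightarrow> set vs \<subseteq> set xs \<Longrightarrow>
    formula L ar xs (Rel P (map FV vs))"
| And: "formula L ar xs \<phi> \<Longrightarrow> formula L ar xs \<psi> \<Longrightarrow> formula L ar xs (And \<phi> \<psi>)"
| Disj: "(\<And>i. formula L ar xs (\<Phi> i)) \<Longrightarrow> formula L ar xs (Disj \<Phi>)"
| Exists: "formula L ar (xs @ [y]) \<phi> \<Longrightarrow> formula L ar xs (exists_fm y \<phi>)"

text \<open>A sequent \<open>(xs, \<phi>, \<psi>)\<close> stands for \<open>\<phi> \<turnstile>\<^sub>x\<^sub>s \<psi>\<close>.\<close>

type_synonym 'p sequent = "var list \<times> 'p fm \<times> 'p fm"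

definition coherent_theory :: "'p set \<Rightarrow> ('p \<Rightarrow> nat) \<Rightarrow> 'p sequent set \<Rightarrow> bool" where
  "coherent_theory L ar T \<longleftrightarrow>
    (\<forall>(xs, \<phi>, \<psi>) \<in> T. formula L ar xs \<phi> \<and> formula L ar xs \<psi>)"

definition eqs_fm :: "var list \<Rightarrow> var list \<Rightarrow> 'p fm" where
  "eqs_fm xs ys = foldr (\<lambda>(u, v) \<chi>. And (Eq (FV u) (FV v)) \<chi>) (zip xs ys) Top"

text \<open>The \<open>formula\<close> premises ensure that every sequent in a derivation consists of formulas over
  \<open>L\<close> in the indicated context.\<close>

inductive derivable ::
  "'p set \<Rightarrow> ('p \<Rightarrow> nat) \<Rightarrow> 'p sequent set \<Rightarrow> var list \<Rightarrow> 'p fm \<Rightarrow> 'p fm \<Rightarrow> bool"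
  for L :: "'p set" and ar :: "'p \<Rightarrow> nat" and T :: "'p sequent set" where
  Axiom: "(xs, \<phi>, \<psi>) \<in> T \<Longrightarrow> derivable L ar T xs \<phi> \<psi>"
| Refl: "formula L ar xs \<phi> \<Longrightarrow> derivable L ar T xs \<phi> \<phi>"
| Cut: "derivable L ar T xs \<phi> \<psi> \<Longrightarrow> derivable L ar T xs \<psi> \<chi> \<Longrightarrow> derivable L ar T xs \<phi> \<chi>"
| Distrib: "formula L ar xs \<phi> \<Longrightarrow> (\<And>i. formula L ar xs (\<Psi> i)) \<Longrightarrow>
    derivable L ar T xs (And \<phi> (Disj \<Psi>)) (Disj (\<lambda>i. And \<phi> (\<Psi> i)))"
| TopI: "formula L ar xs \<phi> \<Longrightarrow> derivable L ar T xs \<phi> Top"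
| AndE1: "formula L ar xs \<phi> \<Longrightarrow> formula L ar xs \<psi> \<Longrightarrow> derivable L ar T xs (And \<phi> \<psi>) \<phi>"
| AndE2: "formula L ar xs \<phi> \<Longrightarrow> formula L ar xs \<psi> \<Longrightarrow> derivable L ar T xs (And \<phi> \<psi>) \<psi>"
| AndI: "derivable L ar T xs \<chi> \<phi> \<Longrightarrow> derivable L ar T xs \<chi> \<psi> \<Longrightarrow>
    derivable L ar T xs \<chi> (And \<phi> \<psi>)"
| BotE: "formula L ar xs \<psi> \<Longrightarrow> derivable L ar T xs Bot \<psi>"
| DisjI: "(\<And>i. formula L ar xs (\<Phi> i)) \<Longrightarrow> derivable L ar T xs (\<Phi> j) (Disj \<Phi>)"
| DisjE: "(\<And>i. derivable L ar T xs (\<Phi> i) \<psi>) \<Longrightarrow> derivable L ar T xs (Disj \<Phi>) \<psi>"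
| Subst: "derivable L ar T xs \<phi> \<psi> \<Longrightarrow> length ss = length xs \<Longrightarrow>
    distinct ys \<Longrightarrow> set ss \<subseteq> set ys \<Longrightarrow>
    derivable L ar T ys (subst_fm xs ss \<phi>) (subst_fm xs ss \<psi>)"
| EqRefl: "distinct xs \<Longrightarrow> v \<in> set xs \<Longrightarrow> derivable L ar T xs Top (Eq (FV v) (FV v))"
| EqSubst: "distinct xs \<Longrightarrow> distinct ys \<Longrightarrow> length xs = length ys \<Longrightarrow>
    set xs \<union> set ys \<subseteq> set zs \<Longrightarrow> formula L ar zs \<phi> \<Longrightarrow>
    derivable L ar T zs (And (eqs_fm xs ys) \<phi>) (subst_fm xs ys \<phi>)"
| ExE: "formula L ar xs \<psi> \<Longrightarrow> derivable L ar T (xs @ [y]) \<phi> \<psi> \<Longrightarrow>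
    derivable L ar T xs (exists_fm y \<phi>) \<psi>"
| ExE_conv: "formula L ar (xs @ [y]) \<phi> \<Longrightarrow> formula L ar xs \<psi> \<Longrightarrow>
    derivable L ar T xs (exists_fm y \<phi>) \<psi> \<Longrightarrow> derivable L ar T (xs @ [y]) \<phi> \<psi>"
| Frobenius: "formula L ar xs \<phi> \<Longrightarrow> formula L ar (xs @ [y]) \<psi> \<Longrightarrow>
    derivable L ar T xs (And \<phi> (exists_fm y \<psi>)) (exists_fm y (And \<phi> \<psi>))"

record 'p pstruct =
  eqv :: "nat \<Rightarrow> nat \<Rightarrow> bool"
  rel :: "'p \<Rightarrow> nat list \<Rightarrow> bool"

text \<open>The library's \<open>part_equivp\<close> is not used because it excludes the empty domain.\<close>

definition is_structure :: "'p set \<Rightarrow> ('p \<Rightarrow> nat) \<Rightarrow> 'p pstruct \<Rightarrow> bool" where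
  "is_structure L ar M \<longleftrightarrow>
    symp (eqv M) \<and> transp (eqv M) \<and>
    (\<forall>P\<in>L. \<forall>as. rel M P as \<longrightarrow> length as = ar P \<and> (\<forall>a\<in>set as. eqv M a a)) \<and>
    (\<forall>P\<in>L. \<forall>as bs. rel M P as \<longrightarrow> list_all2 (eqv M) as bs \<longrightarrow> rel M P bs)"

text \<open>\<open>sat M xs as bs \<phi>\<close>: the free variables \<open>xs\<close> take the values \<open>as\<close>, and the index \<open>BV k\<close>
  takes the value \<open>bs ! k\<close>, where \<open>bs\<close> lists the witnesses chosen for the enclosing quantifiers,
  innermost first. See \<open>sat_exists_fm\<close> below for the quantifier clause in terms of named
  variables and extended contexts.\<close>

primrec val :: "var list \<Rightarrow> nat list \<Rightarrow> nat list \<Rightarrow> tm \<Rightarrow> nat" where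
  "val xs as bs (FV v) = the (map_of (zip xs as) v)"
| "val xs as bs (BV k) = bs ! k"

primrec sat :: "'p pstruct \<Rightarrow> var list \<Rightarrow> nat list \<Rightarrow> nat list \<Rightarrow> 'p fm \<Rightarrow> bool" where
  "sat M xs as bs Bot \<longleftrightarrow> False"
| "sat M xs as bs Top \<longleftrightarrow> (\<forall>a \<in> set as \<union> set bs. eqv M a a)"
| "sat M xs as bs (Eq s t) \<longleftrightarrow>
    eqv M (val xs as bs s) (val xs as bs t) \<and> (\<forall>a \<in> set as \<union> set bs. eqv M a a)"
| "sat M xs as bs (Rel P ts) \<longleftrightarrow>
    rel M P (map (val xs as bs) ts) \<and> (\<forall>a \<in> set as \<union> set bs. eqv M a a)"
| "sat M xs as bs (And \<phi> \<psi>) \<longleftrightarrow> sat M xs as bs \<phi> \<and> sat M xs as bs \<psi>"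
| "sat M xs as bs (Disj \<Phi>) \<longleftrightarrow> (\<exists>i. sat M xs as bs (\<Phi> i))"
| "sat M xs as bs (ExB \<phi>) \<longleftrightarrow> (\<exists>b. eqv M b b \<and> sat M xs as (b # bs) \<phi>)"

definition interp :: "'p pstruct \<Rightarrow> var list \<Rightarrow> 'p fm \<Rightarrow> nat list set" where
  "interp M xs \<phi> = {as. length as = length xs \<and> sat M xs as [] \<phi>}"

definition is_model :: "'p set \<Rightarrow> ('p \<Rightarrow> nat) \<Rightarrow> 'p sequent set \<Rightarrow> 'p pstruct \<Rightarrow> bool" where
  "is_model L ar T M \<longleftrightarrow>
    is_structure L ar M \<and> (\<forall>(ys, \<sigma>, \<theta>) \<in> T. interp M ys \<sigma> \<subseteq> interp M ys \<theta>)"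


text \<open>The remaining lemmas confirm that the encoding has the intended properties.\<close>

primrec lc_tm :: "nat \<Rightarrow> tm \<Rightarrow> bool" where
  "lc_tm k (FV v) \<longleftrightarrow> True"
| "lc_tm k (BV i) \<longleftrightarrow> i < k"

primrec lc_fm :: "nat \<Rightarrow> 'p fm \<Rightarrow> bool" where
  "lc_fm k Bot \<longleftrightarrow> True"
| "lc_fm k Top \<longleftrightarrow> True"
| "lc_fm k (Eq s t) \<longleftrightarrow> lc_tm k s \<and> lc_tm k t"
| "lc_fm k (Rel P ts) \<longleftrightarrow> (\<forall>t\<in>set ts. lc_tm k t)"
| "lc_fm k (And \<phi> \<psi>) \<longleftrightarrow> lc_fm k \<phi> \<and> lc_fm k \<psi>"
| "lc_fm k (Disj \<Phi>) \<longleftrightarrow> (\<forall>i. lc_fm k (\<Phi> i))"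
| "lc_fm k (ExB \<phi>) \<longleftrightarrow> lc_fm (Suc k) \<phi>"

primrec fv_tm :: "tm \<Rightarrow> var set" where
  "fv_tm (FV v) = {v}"
| "fv_tm (BV i) = {}"

primrec fv_fm :: "'p fm \<Rightarrow> var set" where
  "fv_fm Bot = {}"
| "fv_fm Top = {}"
| "fv_fm (Eq s t) = fv_tm s \<union> fv_tm t"
| "fv_fm (Rel P ts) = (\<Union>t\<in>set ts. fv_tm t)"
| "fv_fm (And \<phi> \<psi>) = fv_fm \<phi> \<union> fv_fm \<psi>"
| "fv_fm (Disj \<Phi>) = (\<Union>i. fv_fm (\<Phi> i))"
| "fv_fm (ExB \<phi>) = fv_fm \<phi>"

lemma lc_close_tm: "lc_tm k t \<Longrightarrow> lc_tm (Suc k) (close_tm y k t)"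
  by (cases t) auto

lemma lc_close_fm: "lc_fm k \<phi> \<Longrightarrow> lc_fm (Suc k) (close_fm y k \<phi>)"
  by (induction \<phi> arbitrary: k) (auto simp: lc_close_tm)

lemma fv_close_tm: "fv_tm (close_tm y k t) = fv_tm t - {y}"
  by (cases t) auto

lemma fv_close_fm: "fv_fm (close_fm y k \<phi>) = fv_fm \<phi> - {y}"
  by (induction \<phi> arbitrary: k) (auto simp: fv_close_tm)

lemma formula_distinct: "formula L ar xs \<phi> \<Longrightarrow> distinct xs"
  by (induction rule: formula.induct) auto

lemma formula_lc: "formula L ar xs \<phi> \<Longrightarrow> lc_fm 0 \<phi>"
  by (induction rule: formula.induct) (auto simp: exists_fm_def lc_close_fm)

lemma formula_fv: "formula L ar xs \<phi> \<Longrightarrow> fv_fm \<phi> \<subseteq> set xs"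
  by (induction rule: formula.induct) (auto simp: exists_fm_def fv_close_fm)

lemma close_rename_tm:
  assumes "f y = z" and "\<forall>v \<in> fv_tm t - {y}. f v = g v \<and> f v \<noteq> z"
  shows "close_tm z k (rename_tm f t) = rename_tm g (close_tm y k t)"
  using assms by (cases t) auto

lemma close_rename_fm:
  assumes "f y = z" and S: "\<forall>v \<in> fv_fm \<phi> - {y}. f v = g v \<and> f v \<noteq> z"
  shows "close_fm z k (rename_fm f \<phi>) = rename_fm g (close_fm y k \<phi>)"
proof -
  have tm: "close_tm z k (rename_tm f t) = rename_tm g (close_tm y k t)"
    if "fv_tm t \<subseteq> fv_fm \<phi>" for k t
    by (rule close_rename_tm, rule assms(1)) (use S that in blast)
  have "close_fm z k (rename_fm f \<chi>) = rename_fm g (close_fm y k \<chi>)"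
    if "fv_fm \<chi> \<subseteq> fv_fm \<phi>" for k \<chi>
    using that by (induction \<chi> arbitrary: k) (auto simp: tm UN_subset_iff)
  then show ?thesis by blast
qed

lemma rename_exists_fm:
  assumes "z \<notin> f ` (fv_fm \<phi> - {y})"
  shows "rename_fm f (exists_fm y \<phi>) = exists_fm z (rename_fm (f(y := z)) \<phi>)"
  using assms by (auto simp: exists_fm_def intro!: close_rename_fm[symmetric])

lemma rename_tm_id: "\<forall>v \<in> fv_tm t. f v = v \<Longrightarrow> rename_tm f t = t"
  by (cases t) auto

lemma rename_fm_id: "\<forall>v \<in> fv_fm \<phi>. f v = v \<Longrightarrow> rename_fm f \<phi> = \<phi>"
  by (induction \<phi>) (auto simp: rename_tm_id intro!: map_idI)

text \<open>Renaming a bound variable does not change the formula.\<close>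

lemma exists_fm_alpha:
  assumes "formula L ar (xs @ [y]) \<phi>" and "z \<notin> set xs"
  shows "exists_fm y \<phi> = exists_fm z (subst_fm [y] [z] \<phi>)"
proof -
  have s: "subst_var [y] [z] = id(y := z)"
    by (auto simp: subst_var_def)
  have "rename_fm id (exists_fm y \<phi>) = exists_fm z (rename_fm (id(y := z)) \<phi>)"
    using formula_fv[OF assms(1)] assms(2) by (intro rename_exists_fm) auto
  then show ?thesis
    by (simp add: subst_fm_def s rename_fm_id)
qed

lemma formula_rename:
  assumes "formula L ar xs \<phi>" and "distinct ys" and "f ` set xs \<subseteq> set ys"
  shows "formula L ar ys (rename_fm f \<phi>)"
  using assms
proof (induction arbitrary: f ys rule: formula.induct)
  case (Rel xs P vs)
  then have "formula L ar ys (Rel P (map FV (map f vs)))"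
    by (intro formula.Rel) auto
  then show ?case by (simp add: comp_def)
next
  case (Exists xs y \<phi>)
  obtain z where z: "z \<notin> set ys"
    using ex_new_if_finite[OF infinite_UNIV_nat, of "set ys"] by auto
  have d: "y \<notin> set xs"
    using formula_distinct[OF Exists.hyps] by simp
  have "formula L ar (ys @ [z]) (rename_fm (f(y := z)) \<phi>)"
    using Exists.prems z d by (intro Exists.IH) auto
  moreover have "rename_fm f (exists_fm y \<phi>) = exists_fm z (rename_fm (f(y := z)) \<phi>)"
    using Exists.prems z formula_fv[OF Exists.hyps] by (intro rename_exists_fm) auto
  ultimately show ?case by (simp add: formula.Exists)
qed (auto intro: formula.intros)

text \<open>A formula in a context is a formula in every larger context.\<close>

lemma formula_weaken:
  assumes "formula L ar xs \<phi>" and "distinct ys" and "set xs \<subseteq> set ys"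
  shows "formula L ar ys \<phi>"
  using formula_rename[of L ar xs \<phi> ys id] assms by (simp add: rename_fm_id)

lemma val_close_tm:
  assumes "lc_tm (length bs) t" and "length as = length xs" and "y \<notin> set xs"
  shows "val xs as (bs @ [b]) (close_tm y (length bs) t) = val (xs @ [y]) (as @ [b]) bs t"
proof (cases t)
  case (FV v)
  have n: "map_of (zip xs as) y = None"
    using assms(2,3) by simp
  have "map_of (zip (xs @ [y]) (as @ [b])) = (map_of (zip xs as))(y \<mapsto> b)"
    using assms(2) n by (auto simp: map_add_def fun_eq_iff simp del: map_of_zip_is_None split: option.split)
  then show ?thesis
    using FV by simp
next
  case (BV i)
  then show ?thesis using assms by (simp add: nth_append)
qed

lemma sat_close_fm:
  assumes "lc_fm (length bs) \<phi>" and "length as = length xs" and "y \<notin> set xs"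
  shows "sat M xs as (bs @ [b]) (close_fm y (length bs) \<phi>) = sat M (xs @ [y]) (as @ [b]) bs \<phi>"
  using assms
proof (induction \<phi> arbitrary: bs)
  case (Rel P ts)
  then have "map (val xs as (bs @ [b])) (map (close_tm y (length bs)) ts) =
      map (val (xs @ [y]) (as @ [b]) bs) ts"
    by (auto simp: val_close_tm)
  then show ?case by (simp del: map_map)
next
  case (ExB \<phi>)
  have "sat M xs as ((c # bs) @ [b]) (close_fm y (length (c # bs)) \<phi>) =
      sat M (xs @ [y]) (as @ [b]) (c # bs) \<phi>" for c
    using ExB.prems by (intro ExB.IH) auto
  then show ?case by simp
qed (auto simp: val_close_tm)

text \<open>The quantifier clause of satisfaction for formulas in context.\<close>

lemma sat_exists_fm:
  assumes "formula L ar (xs @ [y]) \<phi>" and "length as = length xs"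
  shows "sat M xs as [] (exists_fm y \<phi>) \<longleftrightarrow>
    (\<exists>b. eqv M b b \<and> sat M (xs @ [y]) (as @ [b]) [] \<phi>)"
  using sat_close_fm[of "[]" \<phi> as xs y M] formula_lc[OF assms(1)] formula_distinct[OF assms(1)]
    assms(2)
  by (simp add: exists_fm_def)

lemma derivable_formula:
  assumes "coherent_theory L ar T" and "derivable L ar T xs \<phi> \<psi>"
  shows "formula L ar xs \<phi> \<and> formula L ar xs \<psi>"
  using assms(2)
proof (induction rule: derivable.induct)
  case (Axiom xs \<phi> \<psi>)
  then show ?case using assms(1) by (auto simp: coherent_theory_def)
next
  case (Subst xs \<phi> \<psi> ss ys)
  have "distinct xs" using Subst.IH formula_distinct by blast
  have "subst_var xs ss ` set xs \<subseteq> set ss"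
  proof
    fix w assume "w \<in> subst_var xs ss ` set xs"
    then obtain v where v: "v \<in> set xs" "w = subst_var xs ss v" by auto
    then obtain u where "map_of (zip xs ss) v = Some u"
      using Subst.hyps by (metis map_of_zip_is_Some)
    then show "w \<in> set ss"
      using v by (auto simp: subst_var_def dest!: map_of_SomeD set_zip_rightD)
  qed
  then show ?case
    using Subst by (auto simp: subst_fm_def intro!: formula_rename)
next
  case (EqSubst xs ys zs \<phi>)
  have dz: "distinct zs" using EqSubst.hyps formula_distinct by blast
  have "subst_var xs ys ` set zs \<subseteq> set zs"
    using EqSubst.hyps
    by (auto simp: subst_var_def split: option.splits dest!: map_of_SomeD set_zip_rightD)
  then have 1: "formula L ar zs (subst_fm xs ys \<phi>)"
    using EqSubst.hyps dz by (auto simp: subst_fm_def intro!: formula_rename)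
  have "formula L ar zs (foldr (\<lambda>(u, v) \<chi>. And (Eq (FV u) (FV v)) \<chi>) ps Top)"
    if "set ps \<subseteq> set zs \<times> set zs" for ps
    using that dz by (induction ps) (auto intro!: formula.intros)
  moreover have "set (zip xs ys) \<subseteq> set zs \<times> set zs"
    using EqSubst.hyps by (auto dest: set_zip_leftD set_zip_rightD)
  ultimately have "formula L ar zs (eqs_fm xs ys)" by (simp add: eqs_fm_def)
  then show ?case using 1 EqSubst.hyps by (auto intro: formula.intros)
next
  case (ExE_conv xs y \<phi> \<psi>)
  then show ?case by (auto intro: formula_weaken dest: formula_distinct)
next
  case (Frobenius xs \<phi> y \<psi>)
  then have "formula L ar (xs @ [y]) \<phi>"
    by (auto intro: formula_weaken dest: formula_distinct)
  then show ?case using Frobenius by (auto intro: formula.intros)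
qed (auto intro: formula.intros dest: formula_distinct)

end

theory Submission
  imports Defs
begin

text \<open>
  Soundness is a rule induction over derivations.  The rules that change the context or the
  variables rest on one fact: satisfaction of a formula depends only on the values of its
  variables up to \<open>eqv M\<close>, so renaming variables amounts to reindexing the assignment
  (\<open>sat_rename\<close>).

  Completeness is a Henkin construction which, for want of a negation, works with single
  formulas instead of consistent sets.  Suppose that \<open>\<phi>\<close> does not derive \<open>\<psi>\<close> in context \<open>xs\<close>.
  Starting from \<open>(xs, \<phi>)\<close>, build a chain of ever stronger formulas in ever larger contexts, none
  of which derives \<open>\<psi>\<close>.  If the current formula \<open>\<chi>\<close> derives a disjunction, one of the
  disjuncts can be conjoined to it: otherwise all \<open>And \<chi> (\<Theta> i)\<close> would derive \<open>\<psi>\<close>, and by the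
  distributive rule so would \<open>\<chi>\<close>.  If \<open>\<chi>\<close> derives \<open>(\<exists>y)\<theta>\<close>, then \<open>\<theta>[z/y]\<close> can be conjoined to it
  in the context enlarged by a fresh variable \<open>z\<close>, by the Frobenius rule
  (\<open>refutation_step\<close>).  Countably many requirements of this kind can be met in a chain of
  length \<open>\<omega>\<close>.

  Let \<open>F\<close> be the set of all formulas derivable from some member of the chain.  It is closed under
  derivability and conjunction, and it omits \<open>\<psi>\<close>.  The variables that occur in the chain form a
  structure whose equality and relations are read off from the atomic formulas in \<open>F\<close>.  A
  formula that holds in this structure belongs to \<open>F\<close> (\<open>sat_imp_mem\<close>); the disjunctive and
  existential cases need introduction rules only.  The converse needs the chosen disjuncts and
  witnesses, so it holds for the formulas whose requirements have been met
  (\<open>mem_imp_sat\<close>).  The two directions are used asymmetrically.  An axiom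
  \<open>\<sigma> \<turnstile> \<theta>\<close> holds because validity of \<open>\<sigma>\<close> puts an instance of \<open>\<sigma>\<close>, and hence of \<open>\<theta>\<close>, in \<open>F\<close>, and
  membership of the latter makes \<open>\<theta>\<close> valid; \<open>\<phi>\<close> is in \<open>F\<close>, hence valid; \<open>\<psi>\<close> is not in \<open>F\<close>,
  hence not valid.  Requirements are therefore needed only for what \<open>\<phi>\<close> and the instances of the
  conclusions of the axioms give rise to by passing to components, and this set is
  countable (\<open>countable_components\<close>).  Since the variables are natural numbers, the structure is
  one on \<open>nat\<close>.
\<close>

section \<open>Renaming and opening of formulas\<close>

lemma rename_tm_comp: "rename_tm g (rename_tm f t) = rename_tm (g \<circ> f) t"
  by (cases t) auto

lemma rename_fm_comp: "rename_fm g (rename_fm f \<chi>) = rename_fm (g \<circ> f) \<chi>"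
  by (induction \<chi>) (auto simp: rename_tm_comp o_def)

lemma rename_tm_cong: "\<forall>v \<in> fv_tm t. f v = g v \<Longrightarrow> rename_tm f t = rename_tm g t"
  by (cases t) auto

lemma rename_fm_cong: "\<forall>v \<in> fv_fm \<chi>. f v = g v \<Longrightarrow> rename_fm f \<chi> = rename_fm g \<chi>"
  by (induction \<chi>) (auto intro!: rename_tm_cong)

lemma subst_var_eq_map_of:
  assumes "length ss = length xs" and "v \<in> set xs"
  shows "subst_var xs ss v = the (map_of (zip xs ss) v)"
  using assms
  by (auto simp: subst_var_def dest: map_of_zip_is_Some[THEN iffD1, rotated] split: option.split)

lemma map_env:
  assumes "distinct xs" and "length as = length xs"
  shows "map (\<lambda>v. the (map_of (zip xs as) v)) xs = as"
  using assms by (intro nth_equalityI) (auto simp: map_of_zip_nth)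

lemma subst_fm_Rel:
  assumes "length as = length xs" and "set vs \<subseteq> set xs"
  shows "subst_fm xs as (Rel P (map FV vs)) = Rel P (map FV (map (val xs as []) (map FV vs)))"
  using assms by (auto simp: subst_fm_def subst_var_eq_map_of)

lemma map_subst_var:
  assumes "distinct xs" and "length ss = length xs"
  shows "map (subst_var xs ss) xs = ss"
proof -
  have "map (subst_var xs ss) xs = map (\<lambda>v. the (map_of (zip xs ss) v)) xs"
    using assms(2) by (auto simp: subst_var_eq_map_of)
  then show ?thesis using map_env[OF assms] by simp
qed

text \<open>Every renaming is a substitution for the variables of the context.  Equalities between
  iterated substitutions are reduced by this lemma to equalities between lists of variables.\<close>

lemma rename_eq_subst_fm:
  assumes "formula L ar xs \<chi>" and "map f xs = ss"
  shows "rename_fm f \<chi> = subst_fm xs ss \<chi>"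
proof -
  have "map (subst_var xs ss) xs = map f xs"
    using assms formula_distinct[OF assms(1)] map_subst_var[of xs ss] by auto
  then have "\<forall>v \<in> set xs. f v = subst_var xs ss v" by auto
  then show ?thesis
    unfolding subst_fm_def using formula_fv[OF assms(1)] by (intro rename_fm_cong) auto
qed

lemma subst_fm_self:
  assumes "formula L ar xs \<chi>"
  shows "subst_fm xs xs \<chi> = \<chi>"
  using rename_eq_subst_fm[OF assms, of id xs] by (simp add: rename_fm_id)

text \<open>\<open>open_fm k z\<close> replaces the bound index \<open>k\<close> by the free variable \<open>z\<close>; for a quantified formula
  \<open>ExB \<theta>\<close>, the instances of its body are \<open>open_fm 0 z \<theta>\<close>.\<close>

primrec open_tm :: "nat \<Rightarrow> var \<Rightarrow> tm \<Rightarrow> tm" where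
  "open_tm k z (FV v) = FV v"
| "open_tm k z (BV i) = (if i = k then FV z else BV i)"

primrec open_fm :: "nat \<Rightarrow> var \<Rightarrow> 'p fm \<Rightarrow> 'p fm" where
  "open_fm k z Bot = Bot"
| "open_fm k z Top = Top"
| "open_fm k z (Eq s t) = Eq (open_tm k z s) (open_tm k z t)"
| "open_fm k z (Rel P ts) = Rel P (map (open_tm k z) ts)"
| "open_fm k z (And \<phi> \<psi>) = And (open_fm k z \<phi>) (open_fm k z \<psi>)"
| "open_fm k z (Disj \<Phi>) = Disj (\<lambda>i. open_fm k z (\<Phi> i))"
| "open_fm k z (ExB \<phi>) = ExB (open_fm (Suc k) z \<phi>)"

lemma open_rename_close_tm:
  "lc_tm k t \<Longrightarrow> open_tm k z (rename_tm f (close_tm y k t)) = rename_tm (f(y := z)) t"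
  by (cases t) auto

lemma open_rename_close_fm:
  "lc_fm k \<chi> \<Longrightarrow> open_fm k z (rename_fm f (close_fm y k \<chi>)) = rename_fm (f(y := z)) \<chi>"
  by (induction \<chi> arbitrary: k) (auto simp: open_rename_close_tm)

lemma formula_DisjD: "formula L ar xs (Disj \<Theta>) \<Longrightarrow> formula L ar xs (\<Theta> i)"
  by (cases rule: formula.cases) (auto simp: exists_fm_def)

lemma formula_EqD:
  "formula L ar xs (Eq (FV u) (FV v)) \<Longrightarrow> u \<in> set xs \<and> v \<in> set xs"
  by (cases rule: formula.cases) (auto simp: exists_fm_def)

lemma formula_RelD:
  assumes "formula L ar xs (Rel P (map FV vs))"
  shows "P \<in> L" and "length vs = ar P" and "set vs \<subseteq> set xs"
proof -
  have "inj FV" by (auto intro: injI)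
  from assms obtain ws where "map FV ws = map FV vs" "P \<in> L" "length ws = ar P"
    "set ws \<subseteq> set xs"
    by (cases rule: formula.cases) (auto simp: exists_fm_def)
  moreover from this(1) \<open>inj FV\<close> have "ws = vs" by (rule map_injective)
  ultimately show "P \<in> L" "length vs = ar P" "set vs \<subseteq> set xs" by simp_all
qed

text \<open>The body of \<open>ExB \<theta>\<close> was closed at some named variable; any fresh \<open>z\<close> can take the place of
  that variable, and this turns \<open>ExB \<theta>\<close> into the form that the rules of the calculus expect.\<close>

lemma formula_ExB_open:
  assumes "formula L ar xs (ExB \<theta>)" and "z \<notin> set xs"
  shows "formula L ar (xs @ [z]) (open_fm 0 z \<theta>)"
    and "ExB \<theta> = exists_fm z (open_fm 0 z \<theta>)"
proof -
  obtain y \<chi> where \<chi>: "formula L ar (xs @ [y]) \<chi>" and \<theta>: "\<theta> = close_fm y 0 \<chi>"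
    using assms(1) by (cases rule: formula.cases) (auto simp: exists_fm_def)
  have d: "distinct (xs @ [y])" using formula_distinct[OF \<chi>] .
  have "subst_var [y] [z] = id(y := z)" by (auto simp: subst_var_def)
  then have o: "open_fm 0 z \<theta> = subst_fm [y] [z] \<chi>"
    using open_rename_close_fm[OF formula_lc[OF \<chi>], of z id y] \<theta>
    by (simp add: subst_fm_def rename_fm_id)
  show "ExB \<theta> = exists_fm z (open_fm 0 z \<theta>)"
    using exists_fm_alpha[OF \<chi> assms(2)] \<theta> o by (simp add: exists_fm_def)
  show "formula L ar (xs @ [z]) (open_fm 0 z \<theta>)"
    unfolding o subst_fm_def
    by (rule formula_rename[OF \<chi>]) (use assms(2) d in \<open>auto simp: subst_var_def\<close>)
qed

section \<open>Soundness\<close>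

lemma sat_dom: "sat M xs as bs \<chi> \<Longrightarrow> \<forall>a \<in> set as \<union> set bs. eqv M a a"
  by (induction \<chi> arbitrary: bs) fastforce+

lemma eqv_refl_left:
  assumes "is_structure L ar M" and "eqv M a b"
  shows "eqv M a a"
  using assms unfolding is_structure_def by (meson sympD transpD)

lemma eqv_iff:
  assumes "is_structure L ar M" and "eqv M a a'" and "eqv M b b'"
  shows "eqv M a b \<longleftrightarrow> eqv M a' b'"
  using assms unfolding is_structure_def by (meson sympD transpD)

lemma rel_iff:
  assumes M: "is_structure L ar M" and "P \<in> L" and E: "list_all2 (eqv M) as bs"
  shows "rel M P as \<longleftrightarrow> rel M P bs"
proof -
  have "list_all2 (eqv M) bs as"
    using E M unfolding is_structure_def list_all2_conv_all_nth by (auto dest: sympD)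
  then show ?thesis using assms unfolding is_structure_def by blast
qed

text \<open>The induction runs over formulas in context, so that a quantifier is met in the form
  \<open>exists_fm y \<chi>\<close> and its witness extends both assignments by the same value.\<close>

lemma sat_rename:
  assumes M: "is_structure L ar M" and "formula L ar xs \<chi>"
    and "length as = length xs" and "length bs = length ys" and "distinct ys"
    and "f ` set xs \<subseteq> set ys"
    and "\<forall>v \<in> set xs. eqv M (the (map_of (zip xs as) v)) (the (map_of (zip ys bs) (f v)))"
    and "\<forall>b \<in> set bs. eqv M b b"
  shows "sat M xs as [] \<chi> \<longleftrightarrow> sat M ys bs [] (rename_fm f \<chi>)"
proof -
  have dom: "\<forall>a \<in> set as. eqv M a a"
    if "distinct xs" "length as = length xs"
      "\<forall>v \<in> set xs. eqv M (the (map_of (zip xs as) v)) (e v)" for xs :: "var list" and as e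
  proof
    fix a assume "a \<in> set as"
    then have "a \<in> set (map (\<lambda>v. the (map_of (zip xs as) v)) xs)"
      using map_env[OF that(1,2)] by simp
    then obtain v where "v \<in> set xs" "a = the (map_of (zip xs as) v)" by auto
    then show "eqv M a a" using that(3) eqv_refl_left[OF M] by blast
  qed
  show ?thesis
    using assms(2-)
  proof (induction arbitrary: f as ys bs rule: formula.induct)
    case (Top xs)
    then show ?case using dom[of xs as] by simp
  next
    case (Eq xs u v)
    then show ?case using dom[of xs as] eqv_iff[OF M] by simp
  next
    case (Rel xs P vs)
    let ?e = "\<lambda>v. the (map_of (zip xs as) v)" and ?e' = "\<lambda>v. the (map_of (zip ys bs) v)"
    have "list_all2 (eqv M) (map ?e vs) (map (?e' \<circ> f) vs)"
      using Rel by (auto simp: list_all2_map1 list_all2_map2 intro!: list_all2_same[THEN iffD2])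
    then have "rel M P (map ?e vs) \<longleftrightarrow> rel M P (map (?e' \<circ> f) vs)"
      using rel_iff[OF M] Rel.hyps by blast
    then show ?case using Rel dom[of xs as] by (simp add: comp_def)
  next
    case (Exists xs y \<chi>)
    obtain z where z: "z \<notin> set ys"
      using ex_new_if_finite[OF infinite_UNIV_nat, of "set ys"] by auto
    have d: "distinct (xs @ [y])" using formula_distinct[OF Exists.hyps] .
    have "fv_fm \<chi> - {y} \<subseteq> set xs" using formula_fv[OF Exists.hyps] by auto
    then have r: "rename_fm f (exists_fm y \<chi>) = exists_fm z (rename_fm (f(y := z)) \<chi>)"
      using Exists.prems z by (intro rename_exists_fm) blast
    have \<chi>': "formula L ar (ys @ [z]) (rename_fm (f(y := z)) \<chi>)"
      using Exists.prems z d by (intro formula_rename[OF Exists.hyps]) auto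
    have "sat M (xs @ [y]) (as @ [c]) [] \<chi> \<longleftrightarrow>
        sat M (ys @ [z]) (bs @ [c]) [] (rename_fm (f(y := z)) \<chi>)" if c: "eqv M c c" for c
    proof (rule Exists.IH)
      have lookup: "the (map_of (zip (us @ [w]) (cs @ [c])) v) =
          (if v = w then c else the (map_of (zip us cs) v))"
        if "length cs = length us" "w \<notin> set us" "v \<in> set us \<or> v = w" for us w cs v
      proof -
        have "map_of (zip us cs) w = None" using that(1,2) by simp
        then show ?thesis using that
          by (auto simp: map_add_def simp del: map_of_zip_is_None split: option.split)
      qed
      show "\<forall>v \<in> set (xs @ [y]). eqv M (the (map_of (zip (xs @ [y]) (as @ [c])) v))
          (the (map_of (zip (ys @ [z]) (bs @ [c])) ((f(y := z)) v)))"
        using Exists.prems d z c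
        by (auto simp: lookup image_subset_iff simp del: zip_append map_of_append)
    qed (use Exists.prems z c d in auto)
    then show ?case
      unfolding r using sat_exists_fm[OF Exists.hyps Exists.prems(1)]
        sat_exists_fm[OF \<chi>' Exists.prems(2)] by blast
  qed auto
qed

lemma sat_weaken:
  assumes "is_structure L ar M" and "formula L ar xs \<chi>"
    and "length as = length xs" and "distinct (xs @ [y])" and "eqv M a a"
    and "\<forall>b \<in> set as. eqv M b b"
  shows "sat M xs as [] \<chi> \<longleftrightarrow> sat M (xs @ [y]) (as @ [a]) [] \<chi>"
proof -
  have "sat M xs as [] \<chi> \<longleftrightarrow> sat M (xs @ [y]) (as @ [a]) [] (rename_fm id \<chi>)"
  proof (rule sat_rename[OF assms(1-3)])
    show "\<forall>v \<in> set xs. eqv M (the (map_of (zip xs as) v))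
        (the (map_of (zip (xs @ [y]) (as @ [a])) (id v)))"
    proof
      fix v assume v: "v \<in> set xs"
      then obtain b where b: "map_of (zip xs as) v = Some b"
        using assms(3) by (metis map_of_zip_is_Some)
      then have "b \<in> set as" by (auto dest!: map_of_SomeD set_zip_rightD)
      then show "eqv M (the (map_of (zip xs as) v))
          (the (map_of (zip (xs @ [y]) (as @ [a])) (id v)))"
        using v b assms(3,4,6) by (auto simp: map_add_def split: option.split)
    qed
  qed (use assms in auto)
  then show ?thesis by (simp add: rename_fm_id)
qed

lemma sat_eqs_fm:
  "length us = length vs \<Longrightarrow> sat M zs as [] (eqs_fm us vs) \<Longrightarrow>
    list_all2 (\<lambda>u v. eqv M (the (map_of (zip zs as) u)) (the (map_of (zip zs as) v))) us vs"
  by (induction us vs rule: list_induct2) (auto simp: eqs_fm_def)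

theorem soundness:
  assumes T: "coherent_theory L ar T" and "is_model L ar T M" and "derivable L ar T xs \<phi> \<psi>"
  shows "interp M xs \<phi> \<subseteq> interp M xs \<psi>"
proof -
  have M: "is_structure L ar M" using assms(2) by (simp add: is_model_def)
  have "\<forall>as. length as = length xs \<longrightarrow> sat M xs as [] \<phi> \<longrightarrow> sat M xs as [] \<psi>"
    using assms(3)
  proof (induction rule: derivable.induct)
    case (Axiom xs \<phi> \<psi>)
    then show ?case using assms(2) unfolding is_model_def interp_def by fast
  next
    case (Subst xs \<phi> \<psi> ss ys)
    show ?case
    proof (intro allI impI)
      fix bs assume bs: "length bs = length ys" and s: "sat M ys bs [] (subst_fm xs ss \<phi>)"
      let ?e = "\<lambda>v. the (map_of (zip ys bs) (subst_var xs ss v))"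
      have fm: "formula L ar xs \<phi>" "formula L ar xs \<psi>"
        using derivable_formula[OF T Subst.hyps(1)] by auto
      have dxs: "distinct xs" using formula_distinct[OF fm(1)] .
      have im: "subst_var xs ss ` set xs \<subseteq> set ys"
        using map_subst_var[OF dxs Subst.hyps(2)] Subst.hyps by (metis set_map)
      have b: "\<forall>b \<in> set bs. eqv M b b" using sat_dom[OF s] by auto
      have "\<forall>v \<in> set xs. eqv M (the (map_of (zip xs (map ?e xs)) v)) (?e v)"
      proof
        fix v assume v: "v \<in> set xs"
        then have "subst_var xs ss v \<in> set ys" using im by auto
        then obtain b' where b': "map_of (zip ys bs) (subst_var xs ss v) = Some b'"
          using bs by (metis map_of_zip_is_Some)
        then have "b' \<in> set bs" by (auto dest!: map_of_SomeD set_zip_rightD)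
        then show "eqv M (the (map_of (zip xs (map ?e xs)) v)) (?e v)"
          using b b' v by (simp add: map_of_zip_map)
      qed
      then have iff: "sat M xs (map ?e xs) [] \<chi> \<longleftrightarrow> sat M ys bs [] (subst_fm xs ss \<chi>)"
        if "formula L ar xs \<chi>" for \<chi>
        unfolding subst_fm_def using that Subst.hyps bs im b by (intro sat_rename[OF M]) auto
      have "sat M xs (map ?e xs) [] \<psi>" using iff[OF fm(1)] s Subst.IH length_map by blast
      then show "sat M ys bs [] (subst_fm xs ss \<psi>)" using iff[OF fm(2)] by blast
    qed
  next
    case (EqRefl xs v)
    show ?case
    proof (intro allI impI)
      fix as assume as: "length as = length xs" "sat M xs as [] (Top :: 'a fm)"
      then obtain a where a: "map_of (zip xs as) v = Some a"
        using EqRefl by (metis map_of_zip_is_Some)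
      then have "a \<in> set as" by (auto dest!: map_of_SomeD set_zip_rightD)
      then show "sat M xs as [] (Eq (FV v) (FV v) :: 'a fm)" using as a by auto
    qed
  next
    case (EqSubst xs ys zs \<phi>)
    show ?case
    proof (intro allI impI)
      fix as assume as: "length as = length zs" and s: "sat M zs as [] (And (eqs_fm xs ys) \<phi>)"
      let ?e = "\<lambda>v. the (map_of (zip zs as) v)"
      have dz: "distinct zs" using formula_distinct[OF EqSubst.hyps(5)] .
      have dom: "\<forall>a \<in> set as. eqv M a a" using sat_dom[OF s] by auto
      have e: "list_all2 (\<lambda>u v. eqv M (?e u) (?e v)) xs ys"
        using sat_eqs_fm[of xs ys M zs as] EqSubst.hyps s by simp
      have "\<forall>v \<in> set zs. eqv M (?e v) (?e (subst_var xs ys v))"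
      proof
        fix v assume v: "v \<in> set zs"
        show "eqv M (?e v) (?e (subst_var xs ys v))"
        proof (cases "v \<in> set xs")
          case True
          then obtain i where i: "i < length xs" "v = xs ! i" by (metis in_set_conv_nth)
          then have "subst_var xs ys v = ys ! i"
            using EqSubst.hyps by (simp add: subst_var_def map_of_zip_nth)
          then show ?thesis using e i by (simp add: list_all2_conv_all_nth)
        next
          case False
          then have "map_of (zip xs ys) v = None" using EqSubst.hyps by simp
          then have "subst_var xs ys v = v" by (simp add: subst_var_def del: map_of_zip_is_None)
          moreover have "?e v \<in> set as"
            using v map_env[OF dz as] by (metis (no_types, lifting) image_eqI set_map)
          ultimately show ?thesis using dom by simp
        qed
      qed
      moreover have "subst_var xs ys ` set zs \<subseteq> set zs"
        using EqSubst.hyps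
        by (auto simp: subst_var_def split: option.splits dest!: map_of_SomeD set_zip_rightD)
      ultimately have "sat M zs as [] \<phi> \<longleftrightarrow> sat M zs as [] (subst_fm xs ys \<phi>)"
        unfolding subst_fm_def using EqSubst.hyps as dz dom by (intro sat_rename[OF M]) auto
      then show "sat M zs as [] (subst_fm xs ys \<phi>)" using s by simp
    qed
  next
    case (ExE xs \<psi> y \<phi>)
    have fm: "formula L ar (xs @ [y]) \<phi>" using derivable_formula[OF T ExE.hyps(2)] by simp
    show ?case
    proof (intro allI impI)
      fix as assume as: "length as = length xs" and s: "sat M xs as [] (exists_fm y \<phi>)"
      obtain b where b: "eqv M b b" "sat M (xs @ [y]) (as @ [b]) [] \<phi>"
        using s sat_exists_fm[OF fm as] by blast
      then have "sat M (xs @ [y]) (as @ [b]) [] \<psi>" using ExE.IH as by simp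
      then show "sat M xs as [] \<psi>"
        using sat_weaken[OF M ExE.hyps(1) as formula_distinct[OF fm] b(1)] sat_dom[OF s] by auto
    qed
  next
    case (ExE_conv xs y \<phi> \<psi>)
    show ?case
    proof (intro allI impI)
      fix cs assume cs: "length cs = length (xs @ [y])" and s: "sat M (xs @ [y]) cs [] \<phi>"
      then obtain as b where c: "cs = as @ [b]" and as: "length as = length xs"
        by (cases cs rule: rev_cases) auto
      have dom: "\<forall>a \<in> set cs. eqv M a a" using sat_dom[OF s] by auto
      then have "sat M xs as [] (exists_fm y \<phi>)"
        using s c sat_exists_fm[OF ExE_conv.hyps(1) as] by auto
      then have "sat M xs as [] \<psi>" using ExE_conv.IH as by simp
      then show "sat M (xs @ [y]) cs [] \<psi>"
        using sat_weaken[OF M ExE_conv.hyps(2) as formula_distinct[OF ExE_conv.hyps(1)]] dom c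
        by auto
    qed
  next
    case (Frobenius xs \<phi> y \<psi>)
    have d: "distinct (xs @ [y])" using formula_distinct[OF Frobenius.hyps(2)] .
    have fm: "formula L ar (xs @ [y]) (And \<phi> \<psi>)"
      using Frobenius.hyps d formula_weaken[OF Frobenius.hyps(1) d] by (auto intro: formula.And)
    show ?case
    proof (intro allI impI)
      fix as assume as: "length as = length xs" and s: "sat M xs as [] (And \<phi> (exists_fm y \<psi>))"
      obtain b where b: "eqv M b b" "sat M (xs @ [y]) (as @ [b]) [] \<psi>"
        using s sat_exists_fm[OF Frobenius.hyps(2) as] by auto
      then have "sat M (xs @ [y]) (as @ [b]) [] \<phi>"
        using sat_weaken[OF M Frobenius.hyps(1) as d b(1)] sat_dom[OF s] s by auto
      then show "sat M xs as [] (exists_fm y (And \<phi> \<psi>))"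
        using b sat_exists_fm[OF fm as] by auto
    qed
  qed (auto dest: sat_dom)
  then show ?thesis by (auto simp: interp_def)
qed

section \<open>The term model of a filter of formulas\<close>

lemma derivable_weaken:
  assumes T: "coherent_theory L ar T" and d: "derivable L ar T xs \<chi> \<theta>"
    and "distinct ys" and "set xs \<subseteq> set ys"
  shows "derivable L ar T ys \<chi> \<theta>"
  using derivable.Subst[OF d refl assms(3,4)] derivable_formula[OF T d]
    subst_fm_self[of L ar xs \<chi>] subst_fm_self[of L ar xs \<theta>] by simp

lemma rename_eqs_fm:
  "length us = length vs \<Longrightarrow> rename_fm f (eqs_fm us vs) = eqs_fm (map f us) (map f vs)"
  by (induction us vs rule: list_induct2) (auto simp: eqs_fm_def)

text \<open>\<open>D\<close> is the set of variables that may occur; the closure condition is restricted to contexts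
  inside \<open>D\<close>, because a sequent in a larger context presupposes that more elements exist.\<close>

locale deductive_filter =
  fixes L :: "'p set" and ar :: "'p \<Rightarrow> nat" and T :: "'p sequent set"
    and D :: "var set" and F :: "'p fm set"
  assumes coherent: "coherent_theory L ar T"
    and mem_formula: "\<chi> \<in> F \<Longrightarrow> \<exists>ys. set ys \<subseteq> D \<and> formula L ar ys \<chi>"
    and mem_Top: "Top \<in> F"
    and mem_And: "\<chi> \<in> F \<Longrightarrow> \<theta> \<in> F \<Longrightarrow> And \<chi> \<theta> \<in> F"
    and mem_derivable: "\<chi> \<in> F \<Longrightarrow> derivable L ar T ys \<chi> \<theta> \<Longrightarrow> set ys \<subseteq> D \<Longrightarrow> \<theta> \<in> F"
begin

definition term_model :: "'p pstruct" where
  "term_model = \<lparr>eqv = (\<lambda>a b. Eq (FV a) (FV b) \<in> F), rel = (\<lambda>P as. Rel P (map FV as) \<in> F)\<rparr>"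

lemma eqv_term_model [simp]: "eqv term_model a b \<longleftrightarrow> Eq (FV a) (FV b) \<in> F"
  and rel_term_model [simp]: "rel term_model P as \<longleftrightarrow> Rel P (map FV as) \<in> F"
  by (simp_all add: term_model_def)

lemma Eq_memD: "Eq (FV a) (FV b) \<in> F \<Longrightarrow> a \<in> D \<and> b \<in> D"
  using mem_formula formula_EqD by blast

lemma Eq_refl_mem: "a \<in> D \<Longrightarrow> Eq (FV a) (FV a) \<in> F"
  using mem_derivable[OF mem_Top derivable.EqRefl[of "[a]" a]] by simp

text \<open>An instance of a sequent lives in the context \<open>remdups as\<close>, the smallest one that contains
  the substituted variables; it is inside \<open>D\<close> even when \<open>xs\<close> is not.\<close>

lemma mem_subst_derivable:
  assumes "derivable L ar T xs \<chi> \<theta>" and "length as = length xs" and "set as \<subseteq> D"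
    and "subst_fm xs as \<chi> \<in> F"
  shows "subst_fm xs as \<theta> \<in> F"
  using derivable.Subst[OF assms(1,2), of "remdups as"] assms(3,4) mem_derivable by auto

lemma mem_eqs_fm: "list_all2 (\<lambda>a b. Eq (FV a) (FV b) \<in> F) as bs \<Longrightarrow> eqs_fm as bs \<in> F"
  by (induction rule: list_all2_induct) (auto simp: eqs_fm_def mem_Top mem_And)

text \<open>The equality rule of the calculus substitutes for all occurrences of a list of distinct
  variables, so it does not apply to \<open>as\<close>, where entries may repeat or also occur in \<open>bs\<close>.  It is
  applied to the context \<open>cs\<close> and a disjoint copy \<open>ds\<close> of it, and \<open>as\<close> and \<open>bs\<close> are substituted
  afterwards.\<close>

lemma Leibniz:
  assumes \<chi>: "formula L ar cs \<chi>" and "length as = length cs"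
    and "list_all2 (\<lambda>a b. Eq (FV a) (FV b) \<in> F) as bs" and "subst_fm cs as \<chi> \<in> F"
  shows "subst_fm cs bs \<chi> \<in> F"
proof -
  define m where "m = Suc (sum_list cs)"
  define ds where "ds = [m..<m + length cs]"
  let ?zs = "cs @ ds"
  define g where "g = subst_var ?zs (as @ bs)"
  have lb: "length bs = length cs" using assms(2,3) list_all2_lengthD by fastforce
  have ds: "distinct ds" "length ds = length cs" by (auto simp: ds_def)
  have dc: "distinct cs" using formula_distinct[OF \<chi>] .
  have "v < m" if "v \<in> set cs" for v
    using member_le_sum_list[OF that] by (simp add: m_def)
  then have dz: "distinct ?zs" using dc ds(1) by (fastforce simp: ds_def)
  have "map g ?zs = as @ bs"
    unfolding g_def using dz assms(2) lb ds(2) by (intro map_subst_var) auto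
  then have g: "map g cs = as" "map g ds = bs"
    using assms(2) by (auto simp: append_eq_append_conv)
  have "set as \<union> set bs \<subseteq> D"
    using assms(3) Eq_memD by (fastforce simp: list_all2_conv_all_nth in_set_conv_nth)
  moreover have "formula L ar ?zs \<chi>" using formula_weaken[OF \<chi> dz] by simp
  then have "derivable L ar T ?zs (And (eqs_fm cs ds) \<chi>) (subst_fm cs ds \<chi>)"
    using dc ds by (intro derivable.EqSubst) auto
  moreover have "subst_fm ?zs (as @ bs) (And (eqs_fm cs ds) \<chi>) =
      And (eqs_fm as bs) (subst_fm cs as \<chi>)"
    using rename_eq_subst_fm[OF \<chi> g(1)] g ds(2) by (simp add: subst_fm_def rename_eqs_fm flip: g_def)
  moreover have "subst_fm ?zs (as @ bs) (subst_fm cs ds \<chi>) = subst_fm cs bs \<chi>"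
  proof -
    have "map (g \<circ> subst_var cs ds) cs = map g (map (subst_var cs ds) cs)" by simp
    also have "\<dots> = bs" using map_subst_var[OF dc ds(2)] g by simp
    finally show ?thesis
      using rename_eq_subst_fm[OF \<chi>, of "g \<circ> subst_var cs ds" bs]
      by (simp add: subst_fm_def rename_fm_comp flip: g_def)
  qed
  ultimately show ?thesis
    using mem_subst_derivable[of ?zs "And (eqs_fm cs ds) \<chi>" "subst_fm cs ds \<chi>" "as @ bs"]
      mem_And[OF mem_eqs_fm[OF assms(3)] assms(4)] assms(2) lb ds(2) by simp
qed

lemma Leibniz_Eq:
  assumes "Eq (FV a) (FV b) \<in> F" and "Eq (FV a) (FV a') \<in> F" and "Eq (FV b) (FV b') \<in> F"
  shows "Eq (FV a') (FV b') \<in> F"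
proof -
  have "formula L ar [0, 1] (Eq (FV 0) (FV 1))" by (intro formula.Eq) auto
  from Leibniz[OF this, of "[a, b]" "[a', b']"] show ?thesis
    using assms by (simp add: subst_fm_def subst_var_def)
qed

lemma Leibniz_Rel:
  assumes "Rel P (map FV as) \<in> F" and "list_all2 (\<lambda>a b. Eq (FV a) (FV b) \<in> F) as bs"
  shows "Rel P (map FV bs) \<in> F"
proof -
  define cs where "cs = [0..<length as]"
  obtain ys where "formula L ar ys (Rel P (map FV as))" using mem_formula[OF assms(1)] by blast
  note P = formula_RelD(1,2)[OF this]
  then have fm: "formula L ar cs (Rel P (map FV cs))"
    by (intro formula.Rel) (auto simp: cs_def)
  have "subst_fm cs ss (Rel P (map FV cs)) = Rel P (map FV ss)" if "length ss = length as" for ss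
  proof -
    have "map (subst_var cs ss) cs = ss"
      using that by (intro map_subst_var) (auto simp: cs_def)
    then have "map FV (map (subst_var cs ss) cs) = map FV ss" by simp
    then show ?thesis by (simp add: subst_fm_def comp_def)
  qed
  then show ?thesis
    using Leibniz[OF fm _ assms(2)] assms list_all2_lengthD[OF assms(2)] by (simp add: cs_def)
qed

lemma is_structure_term_model: "is_structure L ar term_model"
  unfolding is_structure_def
proof (intro conjI ballI allI impI)
  show "symp (eqv term_model)"
  proof (rule sympI)
    fix a b assume "eqv term_model a b"
    then show "eqv term_model b a" using Leibniz_Eq[of a a b a] Eq_refl_mem Eq_memD by simp
  qed
  show "transp (eqv term_model)"
  proof (rule transpI)
    fix a b c assume "eqv term_model a b" and "eqv term_model b c"
    then show "eqv term_model a c" using Leibniz_Eq[of a b a c] Eq_refl_mem Eq_memD by simp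
  qed
  fix P as
  show "length as = ar P" if "rel term_model P as"
    using that mem_formula[of "Rel P (map FV as)"] formula_RelD(2)[of L ar _ P as] by auto
  show "eqv term_model a a" if "rel term_model P as" "a \<in> set as" for a
  proof -
    obtain ys where "set ys \<subseteq> D" "formula L ar ys (Rel P (map FV as))"
      using mem_formula \<open>rel term_model P as\<close> by auto
    then have "a \<in> D" using formula_RelD(3)[of L ar ys P as] \<open>a \<in> set as\<close> by blast
    then show ?thesis by (simp add: Eq_refl_mem)
  qed
  show "rel term_model P bs" if "rel term_model P as" "list_all2 (eqv term_model) as bs" for bs
    using that Leibniz_Rel by (simp add: term_model_def)
qed

lemma sat_term_model_dom:
  assumes "sat term_model xs as [] \<chi>"
  shows "set as \<subseteq> D"
  using sat_dom[OF assms] Eq_memD by auto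

text \<open>Only introduction rules are involved, so this direction of the truth lemma holds for every
  formula and every filter.\<close>

lemma sat_imp_mem:
  assumes "formula L ar xs \<chi>" and "length as = length xs" and "sat term_model xs as [] \<chi>"
  shows "subst_fm xs as \<chi> \<in> F"
  using assms
proof (induction arbitrary: as rule: formula.induct)
  case (Top xs)
  then show ?case by (simp add: subst_fm_def mem_Top)
next
  case (Eq xs u v)
  then show ?case by (simp add: subst_fm_def subst_var_eq_map_of)
next
  case (Rel xs P vs)
  then show ?case by (simp add: subst_fm_Rel)
next
  case (And xs \<phi> \<psi>)
  then show ?case using mem_And by (simp add: subst_fm_def)
next
  case (Disj xs \<Phi>)
  then obtain i where "sat term_model xs as [] (\<Phi> i)" by auto
  then have "subst_fm xs as (\<Phi> i) \<in> F" using Disj by auto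
  moreover have "derivable L ar T xs (\<Phi> i) (Disj \<Phi>)" using Disj.hyps by (rule derivable.DisjI)
  ultimately show ?case
    using mem_subst_derivable Disj.prems sat_term_model_dom by blast
next
  case (Exists xs y \<chi>)
  have d: "distinct (xs @ [y])" using formula_distinct[OF Exists.hyps] .
  have ex: "formula L ar xs (exists_fm y \<chi>)" using Exists.hyps by (rule formula.Exists)
  obtain b where b: "sat term_model (xs @ [y]) (as @ [b]) [] \<chi>"
    using Exists.prems sat_exists_fm[OF Exists.hyps] by blast
  have "derivable L ar T (xs @ [y]) \<chi> (exists_fm y \<chi>)"
    using Exists.hyps ex by (intro derivable.ExE_conv derivable.Refl)
  then have "subst_fm (xs @ [y]) (as @ [b]) (exists_fm y \<chi>) \<in> F"
    using mem_subst_derivable[OF _ _ sat_term_model_dom[OF b] Exists.IH[OF _ b]] Exists.prems(1)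
    by simp
  moreover have "map (subst_var (xs @ [y]) (as @ [b])) (xs @ [y]) = as @ [b]"
    using d Exists.prems by (intro map_subst_var) auto
  then have "map (subst_var (xs @ [y]) (as @ [b])) xs = as" by simp
  then have "subst_fm (xs @ [y]) (as @ [b]) (exists_fm y \<chi>) = subst_fm xs as (exists_fm y \<chi>)"
    using rename_eq_subst_fm[OF ex] by (metis subst_fm_def)
  ultimately show ?case by simp
qed auto

end

text \<open>A component of a quantified formula is an instance of its body by a variable.  With all
  components indexed by natural numbers, the formulas reached from \<open>\<chi>\<close> by passing to components
  are indexed by lists of natural numbers.\<close>

primrec component :: "nat \<Rightarrow> 'p fm \<Rightarrow> 'p fm" where
  "component i Bot = Bot"
| "component i Top = Top"
| "component i (Eq s t) = Eq s t"
| "component i (Rel P ts) = Rel P ts"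
| "component i (And \<phi> \<psi>) = (if i = 0 then \<phi> else \<psi>)"
| "component i (Disj \<Phi>) = \<Phi> i"
| "component i (ExB \<phi>) = open_fm 0 i \<phi>"

definition component_closed :: "'p fm set \<Rightarrow> bool" where
  "component_closed \<Phi> \<longleftrightarrow> (\<forall>\<chi> \<in> \<Phi>. \<forall>i. component i \<chi> \<in> \<Phi>)"

lemma countable_components:
  assumes "countable B"
  obtains \<Phi> where "countable \<Phi>" and "B \<subseteq> \<Phi>" and "component_closed \<Phi>"
proof
  let ?c = "\<lambda>(is, \<chi>). foldr component is \<chi>"
  let ?\<Phi> = "?c ` (UNIV \<times> B)"
  show "countable ?\<Phi>" using assms by (intro countable_image countable_SIGMA) auto
  show "B \<subseteq> ?\<Phi>"
  proof
    fix \<chi> assume "\<chi> \<in> B"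
    then show "\<chi> \<in> ?\<Phi>" by (intro image_eqI[of _ _ "([], \<chi>)"]) auto
  qed
  show "component_closed ?\<Phi>"
    unfolding component_closed_def
  proof (intro ballI allI)
    fix \<chi> i assume "\<chi> \<in> ?\<Phi>"
    then obtain "is" \<theta> where "\<theta> \<in> B" "\<chi> = foldr component is \<theta>" by auto
    then show "component i \<chi> \<in> ?\<Phi>" by (intro image_eqI[of _ _ "(i # is, \<theta>)"]) auto
  qed
qed

text \<open>Primeness and the existence of witnesses are demanded only within \<open>\<Phi>\<close>, which will be
  countable: a chain of length \<open>\<omega>\<close> meets one requirement at a time, whereas there are uncountably
  many formulas.\<close>

locale saturated_filter = deductive_filter L ar T D F
  for L :: "'p set" and ar T D F +
  fixes \<Phi> :: "'p fm set"
  assumes closed: "component_closed \<Phi>"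
    and Bot_notin: "Bot \<notin> F"
    and mem_DisjD: "Disj \<Theta> \<in> F \<Longrightarrow> Disj \<Theta> \<in> \<Phi> \<Longrightarrow> \<exists>i. \<Theta> i \<in> F"
    and mem_ExBD: "ExB \<theta> \<in> F \<Longrightarrow> ExB \<theta> \<in> \<Phi> \<Longrightarrow> \<exists>z \<in> D. open_fm 0 z \<theta> \<in> F"
begin

text \<open>This direction needs the elimination properties of \<open>F\<close> at each stage of the induction, hence
  a set \<open>\<Phi>\<close> that contains the components of its members.\<close>

lemma mem_imp_sat:
  assumes "formula L ar xs \<chi>" and "length as = length xs" and "set as \<subseteq> D"
    and "subst_fm xs as \<chi> \<in> F" and "subst_fm xs as \<chi> \<in> \<Phi>"
  shows "sat term_model xs as [] \<chi>"
  using assms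
proof (induction arbitrary: as rule: formula.induct)
  case (Bot xs)
  then show ?case using Bot_notin by (simp add: subst_fm_def)
next
  case (Top xs)
  then show ?case by (auto simp: Eq_refl_mem)
next
  case (Eq xs u v)
  then show ?case by (auto simp: subst_fm_def subst_var_eq_map_of Eq_refl_mem)
next
  case (Rel xs P vs)
  then show ?case by (auto simp: subst_fm_Rel Eq_refl_mem)
next
  case (And xs \<phi> \<psi>)
  let ?\<phi> = "subst_fm xs as \<phi>" and ?\<psi> = "subst_fm xs as \<psi>"
  have s: "subst_fm xs as (And \<phi> \<psi>) = And ?\<phi> ?\<psi>" by (simp add: subst_fm_def)
  have "component 0 (And ?\<phi> ?\<psi>) \<in> \<Phi>" "component 1 (And ?\<phi> ?\<psi>) \<in> \<Phi>"
    using And.prems s closed by (auto simp: component_closed_def simp del: component.simps)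
  moreover have "?\<phi> \<in> F" "?\<psi> \<in> F"
    using And.prems And.hyps mem_subst_derivable derivable.AndE1 derivable.AndE2 by metis+
  ultimately show ?case using And by auto
next
  case (Disj xs \<Theta>)
  have s: "subst_fm xs as (Disj \<Theta>) = Disj (\<lambda>i. subst_fm xs as (\<Theta> i))"
    by (simp add: subst_fm_def)
  then obtain i where "subst_fm xs as (\<Theta> i) \<in> F" using Disj.prems mem_DisjD by metis
  moreover have "component i (Disj (\<lambda>i. subst_fm xs as (\<Theta> i))) \<in> \<Phi>"
    using Disj.prems s closed by (simp add: component_closed_def del: component.simps)
  ultimately show ?case using Disj by auto
next
  case (Exists xs y \<chi>)
  let ?\<theta> = "rename_fm (subst_var xs as) (close_fm y 0 \<chi>)"
  have d: "distinct (xs @ [y])" using formula_distinct[OF Exists.hyps] .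
  have s: "subst_fm xs as (exists_fm y \<chi>) = ExB ?\<theta>" by (simp add: subst_fm_def exists_fm_def)
  have "map (subst_var xs as) xs = as" using d Exists.prems by (intro map_subst_var) auto
  then have "map ((subst_var xs as)(y := z)) (xs @ [y]) = as @ [z]" for z
    using d by (auto simp: map_fun_upd)
  then have o: "open_fm 0 z ?\<theta> = subst_fm (xs @ [y]) (as @ [z]) \<chi>" for z
    using open_rename_close_fm[OF formula_lc[OF Exists.hyps]] rename_eq_subst_fm[OF Exists.hyps]
    by metis
  obtain z where z: "z \<in> D" "open_fm 0 z ?\<theta> \<in> F" using Exists.prems s mem_ExBD by metis
  have "component z (ExB ?\<theta>) \<in> \<Phi>"
    using Exists.prems s closed by (simp add: component_closed_def del: component.simps)
  then have "sat term_model (xs @ [y]) (as @ [z]) [] \<chi>"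
    using z o Exists.prems by (intro Exists.IH) auto
  moreover have "eqv term_model z z" using z Eq_refl_mem by simp
  ultimately show ?case using sat_exists_fm[OF Exists.hyps] Exists.prems by blast
qed

text \<open>The antecedent of an axiom passes from the model to the filter, where the axiom acts as a
  rule; only the consequent has to pass back.\<close>

lemma is_model_term_model:
  assumes "\<And>ys \<sigma> \<theta> as. (ys, \<sigma>, \<theta>) \<in> T \<Longrightarrow> subst_fm ys as \<theta> \<in> \<Phi>"
  shows "is_model L ar T term_model"
proof -
  have "sat term_model ys as [] \<theta>"
    if ax: "(ys, \<sigma>, \<theta>) \<in> T" and as: "length as = length ys" and s: "sat term_model ys as [] \<sigma>"
    for ys \<sigma> \<theta> as
  proof -
    have fm: "formula L ar ys \<sigma>" "formula L ar ys \<theta>"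
      using coherent ax by (auto simp: coherent_theory_def)
    have "subst_fm ys as \<theta> \<in> F"
      using mem_subst_derivable[OF derivable.Axiom[OF ax] as sat_term_model_dom[OF s]]
        sat_imp_mem[OF fm(1) as s] .
    then show ?thesis
      using mem_imp_sat[OF fm(2) as sat_term_model_dom[OF s]] assms[OF ax] by blast
  qed
  then show ?thesis
    unfolding is_model_def interp_def using is_structure_term_model by auto
qed

end

section \<open>The Henkin chain\<close>

lemma derivable_And_mono:
  assumes "derivable L ar T xs \<chi> \<theta>" and "formula L ar xs \<chi>" and "derivable L ar T xs (And \<chi> \<theta>) \<psi>"
  shows "derivable L ar T xs \<chi> \<psi>"
  using assms by (blast intro: derivable.Cut derivable.AndI derivable.Refl)

lemma refutation_Disj:
  assumes T: "coherent_theory L ar T" and D: "derivable L ar T xs \<chi> (Disj \<Theta>)"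
    and "\<not> derivable L ar T xs \<chi> \<psi>"
  shows "\<exists>i. \<not> derivable L ar T xs (And \<chi> (\<Theta> i)) \<psi>"
proof (rule ccontr)
  assume "\<not> ?thesis"
  then have "derivable L ar T xs (Disj (\<lambda>i. And \<chi> (\<Theta> i))) \<psi>"
    by (intro derivable.DisjE) auto
  moreover have fm: "formula L ar xs \<chi>" "formula L ar xs (Disj \<Theta>)"
    using derivable_formula[OF T D] by auto
  then have "derivable L ar T xs (And \<chi> (Disj \<Theta>)) (Disj (\<lambda>i. And \<chi> (\<Theta> i)))"
    using formula_DisjD by (intro derivable.Distrib) auto
  ultimately show False
    using assms(3) derivable_And_mono[OF D fm(1)] derivable.Cut by blast
qed

lemma refutation_ExB:
  assumes T: "coherent_theory L ar T" and D: "derivable L ar T xs \<chi> (ExB \<theta>)"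
    and "\<not> derivable L ar T xs \<chi> \<psi>" and "formula L ar xs \<psi>" and "z \<notin> set xs"
  shows "\<not> derivable L ar T (xs @ [z]) (And \<chi> (open_fm 0 z \<theta>)) \<psi>"
proof
  assume "derivable L ar T (xs @ [z]) (And \<chi> (open_fm 0 z \<theta>)) \<psi>"
  then have "derivable L ar T xs (exists_fm z (And \<chi> (open_fm 0 z \<theta>))) \<psi>"
    using assms(4) by (intro derivable.ExE)
  moreover have fm: "formula L ar xs \<chi>" "formula L ar xs (ExB \<theta>)"
    using derivable_formula[OF T D] by auto
  have "derivable L ar T xs (And \<chi> (ExB \<theta>)) (exists_fm z (And \<chi> (open_fm 0 z \<theta>)))"
    using derivable.Frobenius[OF fm(1) formula_ExB_open(1)[OF fm(2) assms(5)]]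
      formula_ExB_open(2)[OF fm(2) assms(5)] by metis
  ultimately show False
    using assms(3) derivable_And_mono[OF D fm(1)] derivable.Cut by blast
qed

text \<open>The requirement posed by \<open>\<rho>\<close> is conditional on \<open>\<rho>\<close> being derivable at this stage; when it
  is not, the pair \<open>(xs, \<chi>)\<close> is kept.\<close>

lemma refutation_step:
  assumes T: "coherent_theory L ar T" and \<chi>: "formula L ar xs \<chi>" and \<psi>: "formula L ar xs \<psi>"
    and n: "\<not> derivable L ar T xs \<chi> \<psi>"
  obtains xs' \<chi>' where "formula L ar xs' \<chi>'" and "formula L ar xs' \<psi>"
    and "\<not> derivable L ar T xs' \<chi>' \<psi>"
    and "set xs \<subseteq> set xs'" and "derivable L ar T xs' \<chi>' \<chi>"
    and "\<And>\<Theta>. \<rho> = Disj \<Theta> \<Longrightarrow> derivable L ar T xs \<chi> \<rho> \<Longrightarrow> \<exists>i. derivable L ar T xs' \<chi>' (\<Theta> i)"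
    and "\<And>\<theta>. \<rho> = ExB \<theta> \<Longrightarrow> derivable L ar T xs \<chi> \<rho> \<Longrightarrow>
      \<exists>z \<in> set xs'. derivable L ar T xs' \<chi>' (open_fm 0 z \<theta>)"
proof (cases "derivable L ar T xs \<chi> \<rho> \<and> ((\<exists>\<Theta>. \<rho> = Disj \<Theta>) \<or> (\<exists>\<theta>. \<rho> = ExB \<theta>))")
  case False
  show ?thesis
    by (rule that[OF \<chi> \<psi> n]) (use False \<chi> in \<open>auto intro: derivable.Refl\<close>)
next
  case True
  then have D: "derivable L ar T xs \<chi> \<rho>" by simp
  then have \<rho>: "formula L ar xs \<rho>" using derivable_formula[OF T] by blast
  from True consider (d) \<Theta> where "\<rho> = Disj \<Theta>" | (e) \<theta> where "\<rho> = ExB \<theta>" by blast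
  then show ?thesis
  proof cases
    case d
    then obtain i where i: "\<not> derivable L ar T xs (And \<chi> (\<Theta> i)) \<psi>"
      using refutation_Disj[OF T _ n] D by blast
    have fm: "formula L ar xs (\<Theta> i)" using \<rho> d formula_DisjD by blast
    show ?thesis
      by (rule that[OF formula.And[OF \<chi> fm] \<psi> i])
        (use d \<chi> fm in \<open>auto intro: derivable.AndE1 derivable.AndE2\<close>)
  next
    case e
    obtain z where z: "z \<notin> set xs"
      using ex_new_if_finite[OF infinite_UNIV_nat, of "set xs"] by auto
    have d: "distinct (xs @ [z])" using z formula_distinct[OF \<chi>] by simp
    have fm: "formula L ar (xs @ [z]) (open_fm 0 z \<theta>)"
      using formula_ExB_open(1) \<rho> e z by blast
    have \<chi>\<psi>: "formula L ar (xs @ [z]) \<chi>" "formula L ar (xs @ [z]) \<psi>"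
      using formula_weaken[OF _ d] \<chi> \<psi> by auto
    show ?thesis
      by (rule that[OF formula.And[OF \<chi>\<psi>(1) fm] \<chi>\<psi>(2) refutation_ExB[OF T _ n \<psi> z]])
        (use e D \<chi>\<psi> fm in \<open>auto intro: derivable.AndE1 derivable.AndE2\<close>)
  qed
qed

lemma saturated_filter_exists:
  assumes T: "coherent_theory L ar T" and \<phi>: "formula L ar xs \<phi>" and \<psi>: "formula L ar xs \<psi>"
    and n: "\<not> derivable L ar T xs \<phi> \<psi>" and "countable \<Phi>" and "component_closed \<Phi>"
  obtains D F where "saturated_filter L ar T D F \<Phi>" and "set xs \<subseteq> D" and "\<phi> \<in> F" and "\<psi> \<notin> F"
proof -
  \<comment> \<open>A formula may become derivable only late in the chain, so each requirement has to be
    considered infinitely often; the second component of \<open>prod_decode n\<close> is there for that.\<close>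
  define task where "task n = from_nat_into \<Phi> (fst (prod_decode n))" for n
  define inv where "inv s \<longleftrightarrow> formula L ar (fst s) (snd s) \<and> formula L ar (fst s) \<psi> \<and>
    \<not> derivable L ar T (fst s) (snd s) \<psi>" for s
  define step where "step n s s' \<longleftrightarrow> set (fst s) \<subseteq> set (fst s') \<and>
    derivable L ar T (fst s') (snd s') (snd s) \<and>
    (\<forall>\<Theta>. task n = Disj \<Theta> \<longrightarrow> derivable L ar T (fst s) (snd s) (task n) \<longrightarrow>
      (\<exists>i. derivable L ar T (fst s') (snd s') (\<Theta> i))) \<and>
    (\<forall>\<theta>. task n = ExB \<theta> \<longrightarrow> derivable L ar T (fst s) (snd s) (task n) \<longrightarrow>
      (\<exists>z \<in> set (fst s'). derivable L ar T (fst s') (snd s') (open_fm 0 z \<theta>)))" for n s s'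
  have "\<exists>S. \<forall>n. (inv (S n) \<and> (n = 0 \<longrightarrow> S n = (xs, \<phi>))) \<and> step n (S n) (S (Suc n))"
  proof (rule dependent_nat_choice)
    show "\<exists>s. inv s \<and> ((0 :: nat) = 0 \<longrightarrow> s = (xs, \<phi>))" using \<phi> \<psi> n by (auto simp: inv_def)
    fix s and k :: nat assume "inv s \<and> (k = 0 \<longrightarrow> s = (xs, \<phi>))"
    then have s: "formula L ar (fst s) (snd s)" "formula L ar (fst s) \<psi>"
      "\<not> derivable L ar T (fst s) (snd s) \<psi>" by (auto simp: inv_def)
    obtain xs' \<chi>' where "formula L ar xs' \<chi>'" "formula L ar xs' \<psi>"
      "\<not> derivable L ar T xs' \<chi>' \<psi>" "set (fst s) \<subseteq> set xs'" "derivable L ar T xs' \<chi>' (snd s)"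
      "\<And>\<Theta>. task k = Disj \<Theta> \<Longrightarrow> derivable L ar T (fst s) (snd s) (task k) \<Longrightarrow>
        \<exists>i. derivable L ar T xs' \<chi>' (\<Theta> i)"
      "\<And>\<theta>. task k = ExB \<theta> \<Longrightarrow> derivable L ar T (fst s) (snd s) (task k) \<Longrightarrow>
        \<exists>z \<in> set xs'. derivable L ar T xs' \<chi>' (open_fm 0 z \<theta>)"
      using refutation_step[OF T s, of "task k"] by metis
    then show "\<exists>s'. (inv s' \<and> (Suc k = 0 \<longrightarrow> s' = (xs, \<phi>))) \<and> step k s s'"
      by (intro exI[of _ "(xs', \<chi>')"]) (simp add: inv_def step_def)
  qed
  then obtain S where S: "\<And>n. inv (S n)" "S 0 = (xs, \<phi>)" "\<And>n. step n (S n) (S (Suc n))"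
    by blast
  define X where "X n = fst (S n)" for n
  define C where "C n = snd (S n)" for n
  have C: "formula L ar (X n) (C n)" "\<not> derivable L ar T (X n) (C n) \<psi>"
    "formula L ar (X n) \<psi>" for n
    using S(1)[of n] by (auto simp: inv_def X_def C_def)
  have dX: "distinct (X n)" for n using formula_distinct[OF C(1)] .
  have X_Suc: "set (X n) \<subseteq> set (X (Suc n))" and C_Suc: "derivable L ar T (X (Suc n)) (C (Suc n)) (C n)"
    for n using S(3)[of n] by (auto simp: step_def X_def C_def)
  have X_mono: "set (X n) \<subseteq> set (X m)" if "n \<le> m" for n m
    using that X_Suc by (rule lift_Suc_mono_le[of "\<lambda>n. set (X n)", rotated])
  have C_mono: "derivable L ar T (X m) (C m) (C n)" if "n \<le> m" for n m
    using that
  proof (induction rule: dec_induct)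
    case base
    show ?case using C(1) by (rule derivable.Refl)
  next
    case (step k)
    then show ?case
      using derivable.Cut[OF C_Suc derivable_weaken[OF T step.IH dX X_Suc]] by simp
  qed
  define D where "D = (\<Union>n. set (X n))"
  define F where "F = {\<chi>. \<exists>n. derivable L ar T (X n) (C n) \<chi>}"
  have later: "derivable L ar T (X m) (C m) \<chi>"
    if "derivable L ar T (X n) (C n) \<chi>" "n \<le> m" for n m \<chi>
    using derivable.Cut[OF C_mono[OF that(2)] derivable_weaken[OF T that(1) dX X_mono[OF that(2)]]] .
  have task: "\<exists>m \<ge> n. task m = \<chi>" if "\<chi> \<in> \<Phi>" for n \<chi>
  proof -
    obtain k where "from_nat_into \<Phi> k = \<chi>"
      using subset_range_from_nat_into[OF \<open>countable \<Phi>\<close>] \<open>\<chi> \<in> \<Phi>\<close> by blast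
    then have "task (prod_encode (k, n)) = \<chi>" by (simp add: task_def)
    then show ?thesis using le_prod_encode_2 by blast
  qed
  have met: "\<exists>m. task m = \<chi> \<and> derivable L ar T (X m) (C m) \<chi>" if "\<chi> \<in> F" "\<chi> \<in> \<Phi>" for \<chi>
  proof -
    obtain n where "derivable L ar T (X n) (C n) \<chi>" using \<open>\<chi> \<in> F\<close> by (auto simp: F_def)
    moreover obtain m where "m \<ge> n" "task m = \<chi>" using task \<open>\<chi> \<in> \<Phi>\<close> by blast
    ultimately show ?thesis using later by blast
  qed
  have "saturated_filter L ar T D F \<Phi>"
  proof
    show "coherent_theory L ar T" by (rule T)
    show "component_closed \<Phi>" by (rule assms(6))
    show "Bot \<notin> F"
    proof
      assume "Bot \<in> F"
      then obtain n where "derivable L ar T (X n) (C n) Bot" by (auto simp: F_def)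
      then show False using C(2,3) derivable.Cut derivable.BotE by blast
    qed
    show "Top \<in> F" using derivable.TopI[OF C(1)] by (auto simp: F_def)
    show "\<exists>ys. set ys \<subseteq> D \<and> formula L ar ys \<chi>" if "\<chi> \<in> F" for \<chi>
      using that derivable_formula[OF T] by (auto simp: F_def D_def)
    show "And \<chi> \<theta> \<in> F" if "\<chi> \<in> F" "\<theta> \<in> F" for \<chi> \<theta>
    proof -
      obtain n m where "derivable L ar T (X n) (C n) \<chi>" "derivable L ar T (X m) (C m) \<theta>"
        using \<open>\<chi> \<in> F\<close> \<open>\<theta> \<in> F\<close> by (auto simp: F_def)
      then have "derivable L ar T (X (max n m)) (C (max n m)) (And \<chi> \<theta>)"
        by (intro derivable.AndI later[OF _ max.cobounded1] later[OF _ max.cobounded2])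
      then show ?thesis by (auto simp: F_def)
    qed
    show "\<theta> \<in> F" if "\<chi> \<in> F" "derivable L ar T ys \<chi> \<theta>" "set ys \<subseteq> D" for \<chi> ys \<theta>
    proof -
      obtain n where n: "derivable L ar T (X n) (C n) \<chi>" using \<open>\<chi> \<in> F\<close> by (auto simp: F_def)
      have "\<exists>m. set vs \<subseteq> set (X m)" if "set vs \<subseteq> D" for vs
        using that
      proof (induction vs)
        case (Cons v vs)
        then obtain k m where "v \<in> set (X k)" "set vs \<subseteq> set (X m)" by (auto simp: D_def)
        then have "set (v # vs) \<subseteq> set (X (max k m))"
          using X_mono[of k "max k m"] X_mono[of m "max k m"] by auto
        then show ?case by blast
      qed simp
      then obtain m where m: "set ys \<subseteq> set (X m)" using \<open>set ys \<subseteq> D\<close> by blast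
      then have "derivable L ar T (X (max n m)) \<chi> \<theta>"
        using derivable_weaken[OF T that(2) dX] X_mono[of m "max n m"] by simp
      then have "derivable L ar T (X (max n m)) (C (max n m)) \<theta>"
        using derivable.Cut[OF later[OF n max.cobounded1]] by blast
      then show ?thesis by (auto simp: F_def)
    qed
    show "\<exists>i. \<Theta> i \<in> F" if "Disj \<Theta> \<in> F" "Disj \<Theta> \<in> \<Phi>" for \<Theta>
      using met[OF that] S(3) unfolding step_def F_def X_def C_def by (metis mem_Collect_eq)
    show "\<exists>z \<in> D. open_fm 0 z \<theta> \<in> F" if "ExB \<theta> \<in> F" "ExB \<theta> \<in> \<Phi>" for \<theta>
    proof -
      obtain m where "task m = ExB \<theta>" "derivable L ar T (X m) (C m) (ExB \<theta>)" 
        using met \<open>ExB \<theta> \<in> F\<close> \<open>ExB \<theta> \<in> \<Phi>\<close> by blast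
      then obtain z where "z \<in> set (X (Suc m))"
        "derivable L ar T (X (Suc m)) (C (Suc m)) (open_fm 0 z \<theta>)"
        using S(3)[of m] unfolding step_def X_def C_def by auto
      then show ?thesis by (auto simp: D_def F_def)
    qed
  qed
  moreover have "X 0 = xs" "C 0 = \<phi>" using S(2) by (simp_all add: X_def C_def)
  then have "set xs \<subseteq> D" "\<phi> \<in> F"
    using derivable.Refl[OF C(1)[of 0]] by (auto simp: D_def F_def)
  moreover have "\<psi> \<notin> F" using C(2) by (auto simp: F_def)
  ultimately show thesis by (rule that)
qed

text \<open>The assignment that refutes \<open>\<psi>\<close> is the identity: each variable of the context denotes
  itself.\<close>

theorem theorem9:
  fixes L :: "'p set" and ar :: "'p \<Rightarrow> nat" and T :: "'p sequent set"
    and xs :: "var list" and \<phi> \<psi> :: "'p fm"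
  assumes "countable L"
    and "countable T"
    and "coherent_theory L ar T"
    and "formula L ar xs \<phi>"
    and "formula L ar xs \<psi>"
  shows "derivable L ar T xs \<phi> \<psi> \<longleftrightarrow>
    (\<forall>M :: 'p pstruct. is_model L ar T M \<longrightarrow> interp M xs \<phi> \<subseteq> interp M xs \<psi>)"
proof
  assume "derivable L ar T xs \<phi> \<psi>"
  then show "\<forall>M :: 'p pstruct. is_model L ar T M \<longrightarrow> interp M xs \<phi> \<subseteq> interp M xs \<psi>"
    using soundness[OF assms(3)] by blast
next
  assume valid: "\<forall>M :: 'p pstruct. is_model L ar T M \<longrightarrow> interp M xs \<phi> \<subseteq> interp M xs \<psi>"
  show "derivable L ar T xs \<phi> \<psi>"
  proof (rule ccontr)
    assume n: "\<not> derivable L ar T xs \<phi> \<psi>"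
    let ?instances = "(\<lambda>((ys, \<sigma>, \<theta>), as). subst_fm ys as \<theta>) ` (T \<times> UNIV)"
    have "countable (insert \<phi> ?instances)"
      using assms(2) by (intro countable_insert countable_image countable_SIGMA) auto
    then obtain \<Phi> where \<Phi>: "countable \<Phi>" "insert \<phi> ?instances \<subseteq> \<Phi>" "component_closed \<Phi>"
      by (rule countable_components)
    obtain D F where "saturated_filter L ar T D F \<Phi>" and D: "set xs \<subseteq> D" "\<phi> \<in> F" "\<psi> \<notin> F"
      using saturated_filter_exists[OF assms(3-5) n \<Phi>(1,3)] .
    then interpret saturated_filter L ar T D F \<Phi> by simp
    have "subst_fm ys as \<theta> \<in> \<Phi>" if "(ys, \<sigma>, \<theta>) \<in> T" for ys \<sigma> \<theta> as
      using \<Phi>(2) that by force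
    then have "interp term_model xs \<phi> \<subseteq> interp term_model xs \<psi>"
      using valid is_model_term_model by blast
    moreover have "sat term_model xs xs [] \<phi>"
      using mem_imp_sat[OF assms(4) refl D(1)] D(2) \<Phi>(2) subst_fm_self[OF assms(4)] by simp
    ultimately have "sat term_model xs xs [] \<psi>" by (auto simp: interp_def)
    then show False
      using sat_imp_mem[OF assms(5) refl] subst_fm_self[OF assms(5)] D(3) by simp
  qed
qed

end
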